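(* Let $N>1$ and $s\in\mathbb{N}$ with $1\le s<N/2$. Let $R:\mathbb{R}^N\to[0,\infty)$ satisfy $R(z_1,\ldots,z_N)=R(|z_1|,\ldots,|z_N|)$ for all $\bm{z}=(z_1,\ldots,z_N)\in\mathbb{R}^N$, and suppose $R$ is separable and symmetric on $\mathbb{R}^N$, concave on $\mathcal{U}=[0,\infty)^N$, $R(\mathbf{0})=0$, and $R(\bm{z})>0$ for all $\bm{z}\ne\mathbf{0}$. Then $$\big\{\bm{v}\in\mathbb{R}^N:\ \|\bm{v}_S\|_1<\|\bm{v}_{\overline{S}}\|_1\ \ \forall S\subset\{1,\ldots,N\}\text{ with }\#(S)\le s\big\}$$ $$\subset\ \big\{\bm{v}\in\mathbb{R}^N:\ R(\bm{v}_S)<R(\bm{v}_{\overline{S}})\ \ \forall S\subset\{1,\ldots,N\}\text{ with }\#(S)\le s\big\}.$$ Consequently, for any real matrix $\bm{A}$ with $N$ columns, if $\ker(\bm{A})\setminus\{\mathbf{0}\}$ is contained in the first set, then it is contained in the second set.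
   Context: For $\bm{v}\in\mathbb{R}^N$ and $S\subset\{1,\ldots,N\}$: $\overline{S}$ is the complement of $S$ in $\{1,\ldots,N\}$, $\#(S)$ is the cardinality of $S$, and $\bm{v}_S\in\mathbb{R}^N$ is the vector that agrees with $\bm{v}$ on the coordinates in $S$ and is zero on the coordinates in $\overline{S}$. $R$ is separable on $\mathbb{R}^N$ if there exist functions $r_j:\mathbb{R}\to[0,\infty)$, $j\in\{1,\ldots,N\}$, such that $R(\bm{z})=\sum_{j=1}^N r_j(z_j)$ for every $\bm{z}\in\mathbb{R}^N$. $R$ is symmetric on $\mathbb{R}^N$ if $R(z_{\pi(1)},\ldots,z_{\pi(N)})=R(\bm{z})$ for every $\bm{z}\in\mathbb{R}^N$ and every permutation $\pi$ of $\{1,\ldots,N\}$. $R$ is concave on $\mathcal{U}$ if $R(\lambda\bm{z}+(1-\lambda)\bm{z}')\ge\lambda R(\bm{z})+(1-\lambda)R(\bm{z}')$ for all $\bm{z},\bm{z}'\in\mathcal{U}$ and $0\le\lambda\le1$. *)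

theory Defs
  imports "HOL-Analysis.Analysis"
begin

text \<open>
  Vectors in \<open>\<real>\<^sup>N\<close> are elements of \<^typ>\<open>real ^ 'n\<close> with \<open>N = CARD('n)\<close>, so the finite type \<open>'n\<close>
  plays the role of the index set \<open>{1,\<dots>,N}\<close> and \<open>- S\<close> is the complement of \<open>S\<close> in it.
\<close>

definition vec_restrict :: "real ^ 'n \<Rightarrow> 'n set \<Rightarrow> real ^ 'n" where
  "vec_restrict v S = (\<chi> i. if i \<in> S then v $ i else 0)"

definition l1_norm :: "real ^ 'n \<Rightarrow> real" where
  "l1_norm v = (\<Sum>i\<in>UNIV. \<bar>v $ i\<bar>)"

definition separable :: "(real ^ 'n \<Rightarrow> real) \<Rightarrow> bool" where
  "separable R \<longleftrightarrow> (\<exists>r :: 'n \<Rightarrow> real \<Rightarrow> real.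
     (\<forall>j t. 0 \<le> r j t) \<and> (\<forall>z. R z = (\<Sum>j\<in>UNIV. r j (z $ j))))"

definition symmetric :: "(real ^ 'n \<Rightarrow> real) \<Rightarrow> bool" where
  "symmetric R \<longleftrightarrow> (\<forall>z \<pi>. \<pi> permutes UNIV \<longrightarrow> R (\<chi> i. z $ \<pi> i) = R z)"

definition nonneg_orthant :: "(real ^ 'n) set" where
  "nonneg_orthant = {z. \<forall>i. 0 \<le> z $ i}"

definition matrix_ker :: "real ^ 'n ^ 'm \<Rightarrow> (real ^ 'n) set" where
  "matrix_ker A = {x. A *v x = 0}"

end

theory Submission
  imports Defs
begin

text \<open>
  Symmetry and separability force \<open>R z = (\<Sum>j. f \<bar>z $ j\<bar>)\<close> for a single concave
  \<open>f \<ge> 0\<close> on \<open>[0,\<infinity>)\<close> vanishing only at \<open>0\<close>; such an \<open>f\<close> is nondecreasing and \<open>f t / t\<close> is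
  nonincreasing. Since \<open>f\<close> is nondecreasing, the worst set \<open>S\<close> consists of \<open>s\<close> largest entries
  of \<open>\<bar>v\<bar>\<close>. If \<open>a\<close> is the smallest of these, then \<open>f t \<le> t f a / a\<close> on that set and
  \<open>f t \<ge> t f a / a\<close> off it, so the \<open>\<ell>\<^sub>1\<close> inequality passes to \<open>R\<close>.
\<close>

lemma concave_on_nonneg_imp_mono:
  fixes f :: "real \<Rightarrow> real"
  assumes conc: "concave_on {0..} f" and nonneg: "\<And>t. 0 \<le> t \<Longrightarrow> 0 \<le> f t"
    and "0 \<le> x" "x \<le> y"
  shows "f x \<le> f y"
proof (rule field_le_mult_one_interval)
  fix l :: real
  assume l: "0 < l" "l < 1"
  \<comment> \<open>\<open>y\<close> lies between \<open>x\<close> and a far point \<open>z\<close>, with weight \<open>l\<close> at \<open>x\<close>; then \<open>l\<close> tends to \<open>1\<close>.\<close>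
  define z where "z = (y - l * x) / (1 - l)"
  have "l * x \<le> 1 * x"
    using l assms(3) by (intro mult_right_mono) auto
  then have z: "0 \<le> z"
    using l assms(4) unfolding z_def by (intro divide_nonneg_pos) auto
  have y: "y = (1 - (1 - l)) *\<^sub>R x + (1 - l) *\<^sub>R z"
    using l by (simp add: z_def)
  have "(1 - (1 - l)) * f x + (1 - l) * f z \<le> f ((1 - (1 - l)) *\<^sub>R x + (1 - l) *\<^sub>R z)"
    using concave_onD[OF conc, of "1 - l" x z] l z assms(3) by simp
  moreover have "0 \<le> (1 - l) * f z"
    using l nonneg[OF z] by simp
  ultimately show "l * f x \<le> f y"
    using y by simp
qed

text \<open>The point \<open>a\<close> is the convex combination of \<open>0\<close> and
  \<open>b\<close> with weight \<open>a / b\<close> at \<open>b\<close>. The cross-multiplied form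
  also covers \<open>a = 0\<close> and \<open>b = 0\<close>.\<close>

lemma concave_on_ratio_antimono:
  fixes f :: "real \<Rightarrow> real"
  assumes conc: "concave_on {0..} f" and "f 0 = 0" and "0 \<le> a" "a \<le> b"
  shows "a * f b \<le> b * f a"
proof (cases "b = 0")
  case True
  then show ?thesis using assms by simp
next
  case False
  then have b: "0 < b" using assms by simp
  then have "a / b * f b \<le> f a"
    using concave_onD[OF conc, of "a / b" 0 b] assms by simp
  then show ?thesis
    using b by (simp add: field_simps)
qed

lemma exists_top_subset:
  fixes g :: "'a \<Rightarrow> 'b::linorder"
  assumes "finite A" "k \<le> card A"
  shows "\<exists>T\<subseteq>A. card T = k \<and> (\<forall>i\<in>T. \<forall>j\<in>A - T. g j \<le> g i)"
  using assms(2)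
proof (induction k)
  case 0
  show ?case by (rule exI[of _ "{}"]) auto
next
  case (Suc k)
  then obtain T where T: "T \<subseteq> A" "card T = k" "\<forall>i\<in>T. \<forall>j\<in>A - T. g j \<le> g i"
    by auto
  have fin: "finite (A - T)" "finite T"
    using assms(1) T(1) finite_subset by auto
  have "A - T \<noteq> {}"
    using T Suc.prems by auto
  then have "Max (g ` (A - T)) \<in> g ` (A - T)"
    using fin by simp
  then obtain m where m: "m \<in> A - T" "g m = Max (g ` (A - T))"
    by auto
  have "\<forall>j\<in>A - T. g j \<le> g m"
    using m fin by simp
  \<comment> \<open>Every old element of \<open>T\<close> already dominates \<open>A - T\<close>,
    hence dominates \<open>m\<close> and all that remains.\<close>
  then show ?case
    using T m fin by (intro exI[of _ "insert m T"]) auto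
qed

text \<open>The common part \<open>S \<inter> T\<close> cancels. Of the two differences,
  \<open>T - S\<close> has at least as many elements, and \<open>c\<close> separates the values of
  \<open>h\<close> on them; \<open>0 \<le> c\<close> takes care of the surplus elements.\<close>

lemma sum_le_sum_by_threshold:
  fixes h :: "'a \<Rightarrow> 'b::linordered_semidom"
  assumes "finite S" "finite T" "card S \<le> card T" and "0 \<le> c"
    and le: "\<And>j. j \<in> S - T \<Longrightarrow> h j \<le> c" and ge: "\<And>i. i \<in> T - S \<Longrightarrow> c \<le> h i"
  shows "sum h S \<le> sum h T"
proof -
  have "card (S - T) \<le> card (T - S)"
    using assms by (metis card_le_sym_Diff)
  then have "of_nat (card (S - T)) * c \<le> of_nat (card (T - S)) * c"
    using \<open>0 \<le> c\<close> by (intro mult_right_mono) auto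
  moreover have "sum h (S - T) \<le> of_nat (card (S - T)) * c"
    using le by (rule sum_bounded_above)
  moreover have "of_nat (card (T - S)) * c \<le> sum h (T - S)"
    using ge by (rule sum_bounded_below)
  ultimately have "sum h (S - T) \<le> sum h (T - S)"
    by simp
  moreover have "sum h S = sum h (S \<inter> T) + sum h (S - T)"
    "sum h T = sum h (S \<inter> T) + sum h (T - S)"
    using assms(1,2) sum.Int_Diff[of S h T] sum.Int_Diff[of T h S] by (auto simp: Int_commute)
  ultimately show ?thesis
    by simp
qed

proposition concave_null_space_property:
  fixes f :: "real \<Rightarrow> real" and w :: "'a \<Rightarrow> real"
  assumes "finite A" "s \<le> card A"
    and conc: "concave_on {0..} f" and f0: "f 0 = 0" and pos: "\<And>t. 0 < t \<Longrightarrow> 0 < f t"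
    and w: "\<And>i. i \<in> A \<Longrightarrow> 0 \<le> w i"
    and nsp: "\<And>S. S \<subseteq> A \<Longrightarrow> card S \<le> s \<Longrightarrow> sum w S < sum w (A - S)"
    and S: "S \<subseteq> A" "card S \<le> s"
  shows "(\<Sum>i\<in>S. f (w i)) < (\<Sum>i\<in>A - S. f (w i))"
proof -
  have nonneg: "0 \<le> f t" if "0 \<le> t" for t
    using f0 pos[of t] that by (cases "t = 0") auto
  have mono: "f x \<le> f y" if "0 \<le> x" "x \<le> y" for x y
    using concave_on_nonneg_imp_mono[OF conc nonneg] that by blast
  obtain T where T: "T \<subseteq> A" "card T = s" and top: "\<forall>i\<in>T. \<forall>j\<in>A - T. w j \<le> w i"
    using exists_top_subset[OF assms(1,2)] by blast
  have fin: "finite T" "finite S"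
    using \<open>finite A\<close> T(1) S(1) finite_subset by auto
  show ?thesis
  proof (cases "T = {}")
    \<comment> \<open>Here \<open>s = 0\<close>, so no smallest entry on \<open>T\<close> exists;
      the claim reduces to positivity of the full sum.\<close>
    case True
    then have "S = {}"
      using T S fin by auto
    have "\<exists>i\<in>A. 0 < w i"
    proof (rule ccontr)
      assume "\<not> (\<exists>i\<in>A. 0 < w i)"
      then have "sum w A \<le> 0"
        by (intro sum_nonpos) force
      then show False
        using nsp[of "{}"] by simp
    qed
    then obtain i where "i \<in> A" "0 < w i" by blast
    then have "0 < (\<Sum>i\<in>A. f (w i))"
      using \<open>finite A\<close> w nonneg pos by (intro sum_pos2[of A i]) auto
    then show ?thesis
      using \<open>S = {}\<close> by simp
  next
    case False
    then have "Min (w ` T) \<in> w ` T"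
      using fin by simp
    then obtain m where m: "m \<in> T" "w m = Min (w ` T)"
      by auto
    define a where "a = w m"
    have a_le: "a \<le> w i" if "i \<in> T" for i
      using m fin that by (simp add: a_def)
    have le_a: "w j \<le> a" if "j \<in> A - T" for j
      using top m(1) that unfolding a_def by blast
    have nspT: "sum w T < sum w (A - T)"
      using nsp[of T] T by simp
    have "0 \<le> sum w T"
      using w T by (intro sum_nonneg) auto
    \<comment> \<open>Otherwise the sum of \<open>w\<close> off \<open>T\<close> would be at most
      \<open>0\<close>, against \<open>nspT\<close>.\<close>
    have "0 < a"
    proof (rule ccontr)
      assume "\<not> 0 < a"
      then have "sum w (A - T) \<le> 0"
        using le_a by (intro sum_nonpos) force
      then show False
        using nspT \<open>0 \<le> sum w T\<close> by simp
    qed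
    \<comment> \<open>The ratio lemma is applied to \<open>a \<le> w i\<close> on \<open>T\<close>
      and, at the end of the chain, to \<open>w i \<le> a\<close> off \<open>T\<close>. The factor
      \<open>a\<close> stands in for a division by \<open>w i\<close>, which may vanish off
      \<open>T\<close>.\<close>
    have "a * (\<Sum>i\<in>T. f (w i)) \<le> (\<Sum>i\<in>T. w i * f a)"
      unfolding sum_distrib_left
      using concave_on_ratio_antimono[OF conc f0] a_le \<open>0 < a\<close> by (intro sum_mono) auto
    also have "\<dots> = sum w T * f a"
      by (simp add: sum_distrib_right)
    also have "\<dots> < sum w (A - T) * f a"
      using nspT pos[OF \<open>0 < a\<close>] by simp
    also have "\<dots> = (\<Sum>i\<in>A - T. w i * f a)"
      by (simp add: sum_distrib_right)
    also have "\<dots> \<le> a * (\<Sum>i\<in>A - T. f (w i))"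
      unfolding sum_distrib_left
      using concave_on_ratio_antimono[OF conc f0] le_a w by (intro sum_mono) auto
    finally have T_less: "(\<Sum>i\<in>T. f (w i)) < (\<Sum>i\<in>A - T. f (w i))"
      using \<open>0 < a\<close> by simp
    have S_le: "(\<Sum>i\<in>S. f (w i)) \<le> (\<Sum>i\<in>T. f (w i))"
    proof (rule sum_le_sum_by_threshold[where c = "f a"])
      show "0 \<le> f a"
        using nonneg \<open>0 < a\<close> by simp
      show "f (w j) \<le> f a" if "j \<in> S - T" for j
        using that S(1) le_a w by (intro mono) auto
      show "f a \<le> f (w i)" if "i \<in> T - S" for i
        using that a_le \<open>0 < a\<close> by (intro mono) auto
    qed (use fin S T in auto)
    \<comment> \<open>The total is fixed, so replacing \<open>T\<close> by \<open>S\<close> does not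
      increase the sum over the set and does not decrease the sum over its complement.\<close>
    have "(\<Sum>i\<in>A - S. f (w i)) = (\<Sum>i\<in>A. f (w i)) - (\<Sum>i\<in>S. f (w i))"
      "(\<Sum>i\<in>A - T. f (w i)) = (\<Sum>i\<in>A. f (w i)) - (\<Sum>i\<in>T. f (w i))"
      using \<open>finite A\<close> S T by (auto intro: sum_diff)
    then show ?thesis
      using T_less S_le by linarith
  qed
qed

text \<open>Nonnegativity and \<open>R 0 = 0\<close> force each \<open>r j\<close> to vanish at
  \<open>0\<close>, so \<open>r j\<close> is recovered as \<open>R\<close> on the
  \<open>j\<close>-th axis; swapping \<open>j\<close> and \<open>k\<close> shows that all the
  \<open>r j\<close> coincide.\<close>

lemma separable_symmetric_sum_axis:
  fixes R :: "real ^ 'n \<Rightarrow> real"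
  assumes "separable R" "symmetric R" "R 0 = 0"
  shows "R z = (\<Sum>j\<in>UNIV. R (axis k (z $ j)))"
proof -
  obtain r :: "'n \<Rightarrow> real \<Rightarrow> real" where r: "\<And>j t. 0 \<le> r j t"
    and R: "\<And>z. R z = (\<Sum>j\<in>UNIV. r j (z $ j))"
    using \<open>separable R\<close> unfolding separable_def by blast
  have r0: "r j 0 = 0" for j
    using \<open>R 0 = 0\<close> r by (simp add: R sum_nonneg_eq_0_iff)
  have axis: "R (axis j t) = r j t" for j t
  proof -
    have "R (axis j t) = (\<Sum>i\<in>UNIV. if i = j then r j t else 0)"
      unfolding R by (intro sum.cong) (auto simp: axis_def r0)
    then show ?thesis by simp
  qed
  have "r j t = r k t" for j t
  proof -
    have "(\<chi> i. axis k t $ Transposition.transpose j k i) = axis j t"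
      by (auto simp: vec_eq_iff axis_def Transposition.transpose_def)
    moreover have "Transposition.transpose j k permutes UNIV"
      by (simp add: permutes_swap_id)
    ultimately show ?thesis
      using \<open>symmetric R\<close> unfolding symmetric_def by (metis axis)
  qed
  then show ?thesis
    unfolding axis R[of z] by (intro sum.cong) auto
qed

lemma concave_on_axis:
  fixes R :: "real ^ 'n \<Rightarrow> real"
  assumes "concave_on nonneg_orthant R"
  shows "concave_on {0..} (\<lambda>t. R (axis k t))"
  unfolding concave_on_iff
proof (intro conjI ballI allI impI)
  fix x y u v :: real
  assume *: "x \<in> {0..}" "y \<in> {0..}" "0 \<le> u" "0 \<le> v" "u + v = 1"
  have eq: "axis k (u *\<^sub>R x + v *\<^sub>R y) = u *\<^sub>R axis k x + v *\<^sub>R axis k y"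
    by (simp add: vec_eq_iff axis_def)
  have "axis k x \<in> nonneg_orthant" "axis k y \<in> nonneg_orthant"
    using * by (auto simp: nonneg_orthant_def axis_def)
  then show "u * R (axis k x) + v * R (axis k y) \<le> R (axis k (u *\<^sub>R x + v *\<^sub>R y))"
    using assms * unfolding eq concave_on_iff by blast
qed simp

theorem proposition4p6:
  fixes R :: "real ^ 'n \<Rightarrow> real" and s :: nat and A :: "real ^ 'n ^ 'm"
  assumes "CARD('n) > 1"
    and "1 \<le> s" and "real s < real CARD('n) / 2"
    and "\<And>z. 0 \<le> R z"
    and "\<And>z. R z = R (\<chi> i. \<bar>z $ i\<bar>)"
    and "separable R"
    and "symmetric R"
    and "concave_on nonneg_orthant R"
    and "R 0 = 0"
    and "\<And>z. z \<noteq> 0 \<Longrightarrow> R z > 0"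
  shows "{v. \<forall>S. card S \<le> s \<longrightarrow> l1_norm (vec_restrict v S) < l1_norm (vec_restrict v (- S))}
           \<subseteq> {v. \<forall>S. card S \<le> s \<longrightarrow> R (vec_restrict v S) < R (vec_restrict v (- S))}
         \<and> (matrix_ker A - {0}
             \<subseteq> {v. \<forall>S. card S \<le> s \<longrightarrow> l1_norm (vec_restrict v S) < l1_norm (vec_restrict v (- S))}
           \<longrightarrow> matrix_ker A - {0}
             \<subseteq> {v. \<forall>S. card S \<le> s \<longrightarrow> R (vec_restrict v S) < R (vec_restrict v (- S))})"
proof -
  \<comment> \<open>\<open>undefined\<close> is just some fixed index.\<close>
  define f where "f t = R (axis undefined t)" for t
  have conc: "concave_on {0..} f"
    unfolding f_def by (rule concave_on_axis) fact
  have f0: "f 0 = 0"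
    using \<open>R 0 = 0\<close> by (metis f_def axis_eq_0_iff)
  have pos: "0 < f t" if "0 < t" for t
    using that assms(10) by (simp add: f_def axis_eq_0_iff)
  have "R z = (\<Sum>j\<in>UNIV. f (z $ j))" for z
    unfolding f_def by (rule separable_symmetric_sum_axis) fact+
  \<comment> \<open>Invariance under absolute values moves all arguments into \<open>{0..}\<close>,
    where \<open>f\<close> is concave.\<close>
  then have R: "R z = (\<Sum>j\<in>UNIV. f \<bar>z $ j\<bar>)" for z
    using assms(5)[of z] by simp
  have R_restrict: "R (vec_restrict v S) = (\<Sum>i\<in>S. f \<bar>v $ i\<bar>)" for v S
  proof -
    have "R (vec_restrict v S) = (\<Sum>i\<in>UNIV. if i \<in> S then f \<bar>v $ i\<bar> else 0)"
      unfolding R by (intro sum.cong) (auto simp: vec_restrict_def f0)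
    then show ?thesis by (simp flip: sum.inter_restrict)
  qed
  have l1_restrict: "l1_norm (vec_restrict v S) = (\<Sum>i\<in>S. \<bar>v $ i\<bar>)" for v :: "real ^ 'n" and S
  proof -
    have "l1_norm (vec_restrict v S) = (\<Sum>i\<in>UNIV. if i \<in> S then \<bar>v $ i\<bar> else 0)"
      unfolding l1_norm_def by (intro sum.cong) (auto simp: vec_restrict_def)
    then show ?thesis by (simp flip: sum.inter_restrict)
  qed
  have "s \<le> CARD('n)"
    using assms(3) by linarith
  have "R (vec_restrict v S) < R (vec_restrict v (- S))"
    if nsp: "\<forall>S. card S \<le> s \<longrightarrow> l1_norm (vec_restrict v S) < l1_norm (vec_restrict v (- S))"
      and "card S \<le> s" for v S
    using concave_null_space_property[of UNIV s f "\<lambda>i. \<bar>v $ i\<bar>" S, OF _ \<open>s \<le> CARD('n)\<close> conc f0 pos]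
      that
    by (simp add: R_restrict l1_restrict Compl_eq_Diff_UNIV)
  then show ?thesis
    by blast
qed

end
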